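(* Let $d\ge2$ and let $A\in\mathcal{S}_{rc}^d$. Then: (1) If $\rho_A:\mathbb{S}^{d-1}\to[0,\infty]$ is continuous, then $A$ is closed. (2) The function $d_r(\cdot,A):\mathbb{R}^d\to[0,\infty)$ is continuous if and only if $\rho_A$ is continuous. In particular, $d_r(\cdot,A)$ is continuous if and only if $A\in\mathcal{S}_1^d$.
   Context: $B_2^d$ and $\mathbb{S}^{d-1}$ are the closed Euclidean unit ball and the unit sphere of $\mathbb{R}^d$. A star set is a non-empty $A\subseteq\mathbb{R}^d$ with $ta\in A$ for all $a\in A$, $0\le t\le 1$. Its radial function is $\rho_A:\mathbb{S}^{d-1}\to[0,\infty]$, $\rho_A(\theta)=\sup\{\lambda\ge 0:\lambda\theta\in A\}$. A star body is a star set $A$ that is radially closed: $\rho_A(\theta)\theta\in A$ whenever $\rho_A(\theta)<\infty$; it need not be closed or bounded. $\mathcal{S}_{rc}^d$ is the family of all star bodies in $\mathbb{R}^d$, and $\mathcal{S}_1^d$ the subfamily of those with continuous $\rho_A$ (continuity into $[0,\infty]$ with the usual topology of the extended half-line). The radial sum $A_1\tilde{+}A_2$ is the star body with radial function $\rho_{A_1}+\rho_{A_2}$. The radial distance from $x\in\mathbb{R}^d$ to $A\in\mathcal{S}_{rc}^d$ is $d_r(x,A)=\inf\{\alpha>0: x\in A\tilde{+}\alpha B_2^d\}$. *)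

theory Defs
  imports "HOL-Analysis.Analysis"
begin

definition star_set :: "(real ^ 'n) set \<Rightarrow> bool" where
  "star_set A \<longleftrightarrow> A \<noteq> {} \<and> (\<forall>a\<in>A. \<forall>t\<in>{0..1}. t *\<^sub>R a \<in> A)"

text \<open>Only the values on the unit sphere are meaningful. The type \<^typ>\<open>ennreal\<close> is
  \<open>[0, \<infinity>]\<close> with the usual topology of the extended half-line.\<close>

definition radial_function :: "(real ^ 'n) set \<Rightarrow> real ^ 'n \<Rightarrow> ennreal" where
  "radial_function A \<theta> = (SUP l\<in>{l. 0 \<le> l \<and> l *\<^sub>R \<theta> \<in> A}. ennreal l)"

definition radially_closed :: "(real ^ 'n) set \<Rightarrow> bool" where
  "radially_closed A \<longleftrightarrow>
     (\<forall>\<theta>\<in>sphere 0 1. radial_function A \<theta> < \<infinity> \<longrightarrow> enn2real (radial_function A \<theta>) *\<^sub>R \<theta> \<in> A)"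

definition star_bodies :: "(real ^ 'n) set set" where
  "star_bodies = {A. star_set A \<and> radially_closed A}"

definition continuous_star_bodies :: "(real ^ 'n) set set" where
  "continuous_star_bodies = {A \<in> star_bodies. continuous_on (sphere 0 1) (radial_function A)}"

text \<open>Existence and uniqueness of the described star body are shown in
  \<open>ex1_star_body\<close> below.\<close>

definition radial_sum :: "(real ^ 'n) set \<Rightarrow> (real ^ 'n) set \<Rightarrow> (real ^ 'n) set" where
  "radial_sum A B = (THE C. C \<in> star_bodies \<and>
     (\<forall>\<theta>\<in>sphere 0 1. radial_function C \<theta> = radial_function A \<theta> + radial_function B \<theta>))"

text \<open>The infimum is a genuine one: see \<open>radial_dist_set_nonempty\<close>.\<close>

definition radial_dist :: "real ^ 'n \<Rightarrow> (real ^ 'n) set \<Rightarrow> real" where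
  "radial_dist x A = Inf {\<alpha>. \<alpha> > 0 \<and> x \<in> radial_sum A ((\<lambda>y. \<alpha> *\<^sub>R y) ` cball 0 1)}"

lemma star_setD: "star_set A \<Longrightarrow> a \<in> A \<Longrightarrow> 0 \<le> t \<Longrightarrow> t \<le> 1 \<Longrightarrow> t *\<^sub>R a \<in> A"
  by (simp add: star_set_def)

lemma zero_in_star_set:
  assumes "star_set A" shows "0 \<in> A"
proof -
  obtain a where "a \<in> A" using assms by (auto simp: star_set_def)
  then have "0 *\<^sub>R a \<in> A" using assms unfolding star_set_def by fastforce
  then show ?thesis by simp
qed

lemma star_body_ray_iff:
  assumes A: "A \<in> star_bodies" and th: "\<theta> \<in> sphere 0 1" and l: "0 \<le> l"
  shows "l *\<^sub>R \<theta> \<in> A \<longleftrightarrow> ennreal l \<le> radial_function A \<theta>"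
proof
  assume "l *\<^sub>R \<theta> \<in> A"
  then show "ennreal l \<le> radial_function A \<theta>"
    unfolding radial_function_def using l by (intro SUP_upper) auto
next
  assume le: "ennreal l \<le> radial_function A \<theta>"
  have st: "star_set A" and rc: "radially_closed A" using A by (auto simp: star_bodies_def)
  have down: "l *\<^sub>R \<theta> \<in> A" if "m *\<^sub>R \<theta> \<in> A" "l \<le> m" for m
  proof (cases "m = 0")
    case True then show ?thesis using that l by simp
  next
    case False
    then have "(l / m) *\<^sub>R (m *\<^sub>R \<theta>) \<in> A"
      using that l by (intro star_setD[OF st that(1)]) (auto simp: divide_le_eq_1)
    then show ?thesis using False by simp
  qed
  show "l *\<^sub>R \<theta> \<in> A"
  proof (cases "radial_function A \<theta> < \<infinity>")
    case True
    then have "enn2real (radial_function A \<theta>) *\<^sub>R \<theta> \<in> A"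
      using rc th by (auto simp: radially_closed_def)
    moreover have "l \<le> enn2real (radial_function A \<theta>)"
      using enn2real_mono[OF le] True l by simp
    ultimately show ?thesis by (rule down)
  next
    case False
    then have "ennreal l < radial_function A \<theta>"
      using less_top by fastforce
    then obtain m where "0 \<le> m" "m *\<^sub>R \<theta> \<in> A" "ennreal l < ennreal m"
      unfolding radial_function_def less_SUP_iff by auto
    then show ?thesis using down[of m] l by (simp add: ennreal_less_iff)
  qed
qed

lemma unit_vector_decomp:
  fixes x :: "real ^ 'n"
  assumes "x \<noteq> 0"
  obtains r u where "0 < r" "u \<in> sphere 0 1" "x = r *\<^sub>R u"
proof
  show "0 < norm x" "x /\<^sub>R norm x \<in> sphere 0 1" "x = norm x *\<^sub>R (x /\<^sub>R norm x)"
    using assms by auto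
qed

lemma ex1_star_body:
  fixes f :: "real ^ 'n \<Rightarrow> ennreal"
  shows "\<exists>!C. C \<in> star_bodies \<and> (\<forall>\<theta>\<in>sphere 0 1. radial_function C \<theta> = f \<theta>)"
proof (rule ex_ex1I)
  define C where "C = {x. x = 0 \<or> ennreal (norm x) \<le> f (x /\<^sub>R norm x)}"
  have ray: "l *\<^sub>R \<theta> \<in> C \<longleftrightarrow> ennreal l \<le> f \<theta>" if "\<theta> \<in> sphere 0 1" "0 \<le> l" for l \<theta>
    using that by (cases "l = 0") (auto simp: C_def)
  have rf: "radial_function C \<theta> = f \<theta>" if th: "\<theta> \<in> sphere 0 1" for \<theta>
  proof (rule antisym)
    show "radial_function C \<theta> \<le> f \<theta>"
      unfolding radial_function_def using ray[OF th] by (auto intro: SUP_least)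
    show "f \<theta> \<le> radial_function C \<theta>"
    proof (rule dense_le)
      fix y assume y: "y < f \<theta>"
      then obtain l where l: "0 \<le> l" "y = ennreal l"
        by (cases y) auto
      then have "l *\<^sub>R \<theta> \<in> C" using ray[OF th] y by auto
      then show "y \<le> radial_function C \<theta>"
        unfolding radial_function_def l(2) using l(1) by (intro SUP_upper) auto
    qed
  qed
  have "star_set C"
    unfolding star_set_def
  proof (intro conjI ballI)
    show "C \<noteq> {}" by (auto simp: C_def)
    fix a t assume a: "a \<in> C" and t: "t \<in> {0..1::real}"
    show "t *\<^sub>R a \<in> C"
    proof (cases "a = 0")
      case True then show ?thesis by (simp add: C_def)
    next
      case False
      then have u: "a /\<^sub>R norm a \<in> sphere 0 1" by auto
      have "ennreal (norm a) \<le> f (a /\<^sub>R norm a)" using a False by (simp add: C_def)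
      moreover have "ennreal (t * norm a) \<le> ennreal (norm a)"
        using t by (intro ennreal_leI) (simp add: mult_left_le_one_le)
      ultimately have "ennreal (t * norm a) \<le> f (a /\<^sub>R norm a)"
        by (rule order_trans[rotated])
      moreover have "0 \<le> t * norm a" using t by simp
      ultimately have "(t * norm a) *\<^sub>R (a /\<^sub>R norm a) \<in> C"
        using ray[OF u] by blast
      moreover have "(t * norm a) *\<^sub>R (a /\<^sub>R norm a) = t *\<^sub>R a"
        using False by (simp add: field_simps)
      ultimately show ?thesis by metis
    qed
  qed
  moreover have "radially_closed C"
    unfolding radially_closed_def by (auto simp: rf ray)
  ultimately show "\<exists>C. C \<in> star_bodies \<and> (\<forall>\<theta>\<in>sphere 0 1. radial_function C \<theta> = f \<theta>)"
    using rf by (auto simp: star_bodies_def)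
next
  fix C D :: "(real ^ 'n) set"
  assume C: "C \<in> star_bodies \<and> (\<forall>\<theta>\<in>sphere 0 1. radial_function C \<theta> = f \<theta>)"
    and D: "D \<in> star_bodies \<and> (\<forall>\<theta>\<in>sphere 0 1. radial_function D \<theta> = f \<theta>)"
  have "x \<in> C \<longleftrightarrow> x \<in> D" for x
  proof (cases "x = 0")
    case True
    then show ?thesis using C D zero_in_star_set by (auto simp: star_bodies_def)
  next
    case False
    then obtain r u where x: "0 < r" "u \<in> sphere 0 1" "x = r *\<^sub>R u"
      by (rule unit_vector_decomp)
    then show ?thesis
      using star_body_ray_iff[of C u r] star_body_ray_iff[of D u r] C D by auto
  qed
  then show "C = D" by blast
qed

lemma radial_sum_props:
  "radial_sum A B \<in> star_bodies"
  "\<theta> \<in> sphere 0 1 \<Longrightarrow>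
     radial_function (radial_sum A B) \<theta> = radial_function A \<theta> + radial_function B \<theta>"
  using theI'[OF ex1_star_body[of "\<lambda>\<theta>. radial_function A \<theta> + radial_function B \<theta>"]]
  by (auto simp: radial_sum_def)

lemma radial_dist_set_nonempty:
  fixes x :: "real ^ 'n"
  shows "{\<alpha>. \<alpha> > 0 \<and> x \<in> radial_sum A ((\<lambda>y. \<alpha> *\<^sub>R y) ` cball 0 1)} \<noteq> {}"
proof (cases "x = 0")
  case True
  then show ?thesis
    using zero_in_star_set radial_sum_props(1) gt_ex[of "0::real"] by (auto simp: star_bodies_def)
next
  case False
  then obtain r u where x: "0 < r" "u \<in> sphere 0 1" "x = r *\<^sub>R u"
    by (rule unit_vector_decomp)
  let ?B = "(\<lambda>y. r *\<^sub>R y) ` cball 0 1"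
  have "r *\<^sub>R u \<in> ?B" using x(2) by auto
  then have "ennreal r \<le> radial_function ?B u"
    unfolding radial_function_def using x(1) by (intro SUP_upper) auto
  then have "ennreal r \<le> radial_function (radial_sum A ?B) u"
    unfolding radial_sum_props(2)[OF x(2)] by (simp add: add_increasing)
  then have "r *\<^sub>R u \<in> radial_sum A ?B"
    using star_body_ray_iff[OF radial_sum_props(1) x(2), of r A ?B] x(1) by simp
  then show ?thesis unfolding x(3) using x(1) by blast
qed

lemma radial_dist_nonneg: "0 \<le> radial_dist x A"
  unfolding radial_dist_def by (rule cInf_greatest[OF radial_dist_set_nonempty]) auto

end

theory Submission imports Defs begin

text \<open>For a unit vector \<open>u\<close> and \<open>r \<ge> 0\<close> the radial distance of \<open>r u\<close> to \<open>A\<close> is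
  \<open>r - min(r, \<rho>\<^sub>A(u))\<close>. Hence a continuous \<open>\<rho>\<^sub>A\<close> gives a continuous distance; at the origin
  this uses that the distance is bounded by the norm. Conversely a continuous distance makes every
  truncation \<open>min(r, \<rho>\<^sub>A)\<close> continuous, hence also \<open>\<rho>\<^sub>A\<close>. Finally, \<open>A\<close> is the zero set of
  its radial distance.\<close>

lemma radial_function_scaled_ball:
  fixes u :: "real ^ 'n"
  assumes u: "u \<in> sphere 0 1" and a: "0 < \<alpha>"
  shows "radial_function ((\<lambda>y. \<alpha> *\<^sub>R y) ` cball 0 1) u = ennreal \<alpha>"
proof -
  have "{l. 0 \<le> l \<and> l *\<^sub>R u \<in> (\<lambda>y. \<alpha> *\<^sub>R y) ` cball 0 1} = {0..\<alpha>}"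
    using u a cball_scale[of \<alpha> "0 :: real ^ 'n" 1] by auto
  moreover have "(SUP l\<in>{0..\<alpha>}. ennreal l) = ennreal \<alpha>"
    using a by (intro cSup_eq_maximum) (auto intro: ennreal_leI)
  ultimately show ?thesis
    unfolding radial_function_def by simp
qed

lemma ray_in_radial_sum_ball_iff:
  fixes u :: "real ^ 'n"
  assumes "u \<in> sphere 0 1" "0 \<le> r" "0 < \<alpha>"
  shows "r *\<^sub>R u \<in> radial_sum A ((\<lambda>y. \<alpha> *\<^sub>R y) ` cball 0 1) \<longleftrightarrow>
    ennreal r \<le> radial_function A u + ennreal \<alpha>"
  unfolding star_body_ray_iff[OF radial_sum_props(1) assms(1,2)]
    radial_sum_props(2)[OF assms(1)] radial_function_scaled_ball[OF assms(1,3)] ..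

text \<open>On a ray, the infimum defining \<open>radial_dist\<close> takes this form. For
  \<open>c = 0\<close> the condition \<open>0 < \<alpha>\<close> removes the minimum but leaves the
  infimum unchanged.\<close>

lemma Inf_positive_atLeast:
  fixes c :: real
  assumes "0 \<le> c"
  shows "Inf {\<alpha>. 0 < \<alpha> \<and> c \<le> \<alpha>} = c"
proof (cases "c = 0")
  case True
  then have "{\<alpha>. 0 < \<alpha> \<and> c \<le> \<alpha>} = {0<..}" by auto
  then show ?thesis using True by simp
next
  case False
  then have "{\<alpha>. 0 < \<alpha> \<and> c \<le> \<alpha>} = {c..}" using assms by auto
  then show ?thesis by simp
qed

text \<open>The admissible \<alpha> are those with \<open>r\<close> at most
  \<open>radial_function A u\<close> plus \<alpha>. Truncating at \<open>r\<close> keeps the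
  subtrahend finite, so \<open>enn2real\<close> loses nothing even if the radial function is
  infinite.\<close>

lemma radial_dist_ray:
  fixes u :: "real ^ 'n"
  assumes u: "u \<in> sphere 0 1" and r: "0 \<le> r"
  shows "radial_dist (r *\<^sub>R u) A = r - enn2real (min (ennreal r) (radial_function A u))"
proof -
  define m where "m = enn2real (min (ennreal r) (radial_function A u))"
  have m: "0 \<le> m" "ennreal m = min (ennreal r) (radial_function A u)"
    by (auto simp: m_def min_less_iff_disj)
  then have mr: "m \<le> r"
    using r by (metis ennreal_le_iff min.cobounded1)
  have "ennreal r \<le> radial_function A u + ennreal \<alpha> \<longleftrightarrow> r - m \<le> \<alpha>" if a: "0 < \<alpha>" for \<alpha>
  proof (cases "radial_function A u")
    case (real s)
    then have "m = min r s" using m r by (simp add: min_def split: if_splits)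
    then show ?thesis using real a r by (simp flip: ennreal_plus) linarith
  next
    \<comment> \<open>Here \<open>m = r\<close>, and both sides of the equivalence are true.\<close>
    case top
    then show ?thesis using m r a by (simp add: min_def top_unique split: if_splits)
  qed
  then have "{\<alpha>. 0 < \<alpha> \<and> r *\<^sub>R u \<in> radial_sum A ((\<lambda>y. \<alpha> *\<^sub>R y) ` cball 0 1)} =
      {\<alpha>. 0 < \<alpha> \<and> r - m \<le> \<alpha>}"
    using ray_in_radial_sum_ball_iff[OF u r] by auto
  then show ?thesis
    using mr Inf_positive_atLeast[of "r - m"] by (simp add: radial_dist_def m_def)
qed

lemma radial_dist_0 [simp]: "radial_dist (0 :: real ^ 'n) A = 0"
  \<comment> \<open>The origin lies on every ray at \<open>r = 0\<close>; a coordinate vector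
    supplies a unit direction.\<close>
  using radial_dist_ray[of "axis undefined 1 :: real ^ 'n" 0 A] by simp

text \<open>The ray formula solved for the truncation, so that properties of the distance pass to
  the radial function.\<close>

lemma min_radial_function_eq:
  fixes u :: "real ^ 'n"
  assumes "u \<in> sphere 0 1" "0 \<le> r"
  shows "min (ennreal r) (radial_function A u) = ennreal (r - radial_dist (r *\<^sub>R u) A)"
  by (simp add: radial_dist_ray[OF assms] min_less_iff_disj)

lemma radial_dist_le_norm: "radial_dist x A \<le> norm x"
proof (cases "x = 0")
  case False
  then obtain r u where "0 < r" "u \<in> sphere 0 1" "x = r *\<^sub>R u"
    by (rule unit_vector_decomp)
  then show ?thesis by (simp add: radial_dist_ray)
qed simp

lemma continuous_radial_dist:
  fixes A :: "(real ^ 'n) set"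
  assumes "continuous_on (sphere 0 1) (radial_function A)"
  shows "continuous_on UNIV (\<lambda>x. radial_dist x A)"
proof -
  have eq: "radial_dist x A = norm x - enn2real (min (ennreal (norm x)) (radial_function A (x /\<^sub>R norm x)))"
    if "x \<noteq> 0" for x
    using radial_dist_ray[of "x /\<^sub>R norm x" "norm x" A] that by simp
  \<comment> \<open>The direction of \<open>x\<close> depends continuously on \<open>x\<close> only
    away from the origin, which is treated separately below.\<close>
  have "continuous_on (-{0}) (\<lambda>x. radial_function A (x /\<^sub>R norm x))"
    by (rule continuous_on_compose2[OF assms]) (auto intro!: continuous_intros simp: field_simps split: if_splits)
  then have "continuous_on (-{0})
      (\<lambda>x. min (ennreal (norm x)) (radial_function A (x /\<^sub>R norm x)))"
    by (intro continuous_on_min continuous_on_ennreal continuous_intros)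
  then have "continuous_on (-{0})
      (\<lambda>x. norm x - enn2real (min (ennreal (norm x)) (radial_function A (x /\<^sub>R norm x))))"
    \<comment> \<open>\<open>enn2real\<close> is continuous at finite values, and the minimum with
      \<open>norm x\<close> is finite.\<close>
    by (auto simp: continuous_on_def min_less_iff_disj intro!: tendsto_intros tendsto_enn2real)
  then have "continuous_on (-{0}) (\<lambda>x. radial_dist x A)"
    by (rule continuous_on_eq) (simp add: eq)
  then have "isCont (\<lambda>x. radial_dist x A) x" if "x \<noteq> 0" for x
    using that by (auto simp: continuous_on_eq_continuous_at open_Compl)
  moreover have "isCont (\<lambda>x. radial_dist x A) 0"
  proof -
    have "((\<lambda>x :: real ^ 'n. norm x) \<longlongrightarrow> 0) (at 0)"
      by (intro tendsto_norm_zero tendsto_ident_at)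
    then have "((\<lambda>x. radial_dist x A) \<longlongrightarrow> 0) (at 0)"
      by (rule Lim_null_comparison[rotated])
         (simp add: radial_dist_nonneg radial_dist_le_norm)
    then show ?thesis
      by (simp add: isCont_def)
  qed
  ultimately show ?thesis
    by (metis continuous_at_imp_continuous_on)
qed

text \<open>Each strict bound on \<open>f x\<close>, from below or above, is already detected by one
  truncation at a suitable finite level.\<close>

lemma continuous_on_ennreal_truncations:
  fixes f :: "'a :: topological_space \<Rightarrow> ennreal"
  assumes "\<And>r. 0 \<le> r \<Longrightarrow> continuous_on S (\<lambda>x. min (ennreal r) (f x))"
  shows "continuous_on S f"
  unfolding continuous_on_def
proof (intro ballI order_tendstoI)
  fix x a assume x: "x \<in> S"
  have lim: "((\<lambda>y. min (ennreal r) (f y)) \<longlongrightarrow> min (ennreal r) (f x)) (at x within S)" if "0 \<le> r" for r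
    using assms[OF that] x by (simp add: continuous_on_def)
  {
    assume "a < f x"
    \<comment> \<open>Lying below \<open>f x\<close>, \<open>a\<close> is finite, so some real level
      exceeds it; then \<open>a\<close> is also below the truncated value at
      \<open>x\<close>.\<close>
    then obtain r where r: "0 \<le> r" "a < ennreal r"
      by (metis ennreal_cases ennreal_enn2real dense less_top order_less_le_trans top_greatest enn2real_nonneg)
    have "\<forall>\<^sub>F y in at x within S. a < min (ennreal r) (f y)"
      using order_tendstoD(1)[OF lim[OF r(1)]] r \<open>a < f x\<close> by simp
    then show "\<forall>\<^sub>F y in at x within S. a < f y" by (rule eventually_mono) simp
  next
    assume "f x < a"
    \<comment> \<open>With \<open>r\<close> strictly between \<open>f x\<close> and
      \<open>a\<close>, a truncated value below \<open>r\<close> must be \<open>f y\<close>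
      itself.\<close>
    then obtain r where r: "0 \<le> r" "f x < ennreal r" "ennreal r < a"
      by (metis dense ennreal_enn2real less_top order_less_le_trans top_greatest enn2real_nonneg)
    have "\<forall>\<^sub>F y in at x within S. min (ennreal r) (f y) < ennreal r"
      using order_tendstoD(2)[OF lim[OF r(1)]] r by simp
    then show "\<forall>\<^sub>F y in at x within S. f y < a"
      by (rule eventually_mono) (use r(3) in \<open>auto simp: min_less_iff_disj\<close>)
  }
qed

lemma continuous_radial_function:
  fixes A :: "(real ^ 'n) set"
  assumes "continuous_on UNIV (\<lambda>x. radial_dist x A)"
  shows "continuous_on (sphere 0 1) (radial_function A)"
proof (rule continuous_on_ennreal_truncations)
  fix r :: real assume r: "0 \<le> r"
  have "continuous_on (sphere 0 1) (\<lambda>u. ennreal (r - radial_dist (r *\<^sub>R u) A))"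
    by (intro continuous_on_ennreal continuous_intros continuous_on_compose2[OF assms]) auto
  then show "continuous_on (sphere 0 1) (\<lambda>u. min (ennreal r) (radial_function A u))"
    by (rule continuous_on_eq) (simp add: min_radial_function_eq r)
qed

lemma radial_dist_eq_0_iff:
  assumes "A \<in> star_bodies"
  shows "radial_dist x A = 0 \<longleftrightarrow> x \<in> A"
proof (cases "x = 0")
  case True
  then show ?thesis using assms zero_in_star_set by (auto simp: star_bodies_def)
next
  case False
  then obtain r u where x: "0 < r" "u \<in> sphere 0 1" "x = r *\<^sub>R u"
    by (rule unit_vector_decomp)
  have "radial_dist x A = 0 \<longleftrightarrow> ennreal r = min (ennreal r) (radial_function A u)"
    \<comment> \<open>The norm bound makes \<open>r - radial_dist x A\<close> nonnegative, so
      \<open>ennreal\<close> can be cancelled.\<close>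
    using min_radial_function_eq[of u r A] x radial_dist_le_norm[of x A] by auto
  also have "\<dots> \<longleftrightarrow> x \<in> A"
    using star_body_ray_iff[OF assms x(2), of r] x by (auto simp: min_def)
  finally show ?thesis .
qed

theorem proposition2p4:
  fixes A :: "(real ^ 'n) set"
  assumes "CARD('n) \<ge> 2" and "A \<in> star_bodies"
  shows "(continuous_on (sphere 0 1) (radial_function A) \<longrightarrow> closed A) \<and>
         (continuous_on UNIV (\<lambda>x. radial_dist x A) \<longleftrightarrow>
            continuous_on (sphere 0 1) (radial_function A)) \<and>
         (continuous_on UNIV (\<lambda>x. radial_dist x A) \<longleftrightarrow> A \<in> continuous_star_bodies)"
proof -
  have iff: "continuous_on UNIV (\<lambda>x. radial_dist x A) \<longleftrightarrow>
      continuous_on (sphere 0 1) (radial_function A)"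
    using continuous_radial_dist continuous_radial_function by blast
  have "closed A" if "continuous_on (sphere 0 1) (radial_function A)"
  proof -
    have "closed ((\<lambda>x. radial_dist x A) -` {0})"
      using continuous_radial_dist[OF that] by (intro continuous_closed_vimage)
        (auto simp: continuous_on_eq_continuous_at)
    moreover have "(\<lambda>x. radial_dist x A) -` {0} = A"
      using radial_dist_eq_0_iff[OF assms(2)] by auto
    ultimately show ?thesis by simp
  qed
  with iff show ?thesis
    using assms(2) by (auto simp: continuous_star_bodies_def)
qed

end
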